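(* Let $G$ and $H$ be finite simple connected graphs, and let $\mathcal{C}$ be one of the classes DDR, CDDR, DMR. Suppose $G$ and $H$ both belong to $\mathcal{C}$, both are DWR, and at least one of them is non-bipartite. Then the direct product $G\times H$ belongs to $\mathcal{C}$.
   Context: $\Gamma_i(u)$ is the set of vertices at distance exactly $i$ from $u$. For a finite simple graph $G$: DDR (distance degree-regular): $|\Gamma_i(u)|=|\Gamma_i(v)|$ for all vertices $u,v$ and all $i$. CDDR (commutative distance degree-regular): $|\Gamma_i(u)\cap\Gamma_j(v)|=|\Gamma_i(v)\cap\Gamma_j(u)|$ for all vertices $u,v$ and all $1\le i,j\le\operatorname{diam}(G)$. DMR (distance mean-regular): for all $0\le h,i,j\le\operatorname{diam}(G)$ the average $\frac{1}{|\Gamma_h(u)|}\sum_{v\in\Gamma_h(u)}|\Gamma_i(u)\cap\Gamma_j(v)|$ depends only on $h,i,j$ and not on $u$. DWR (distance walk regular): $G$ is connected and for every $k\in\mathbb{N}$ and vertices $u,v$, whether there exists a walk of length $k$ from $u$ to $v$ depends only on $k$ and $d(u,v)$. The direct (tensor) product $G\times H$ has vertex set $V(G)\times V(H)$, and $(g_1,h_1)\sim(g_2,h_2)$ iff $g_1\sim g_2$ and $h_1\sim h_2$. (If a product graph happens to be disconnected, vertices in different components are at distance $\infty$ and $\operatorname{diam}$ means the largest finite distance.) *)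

theory Defs
  imports "Graph_Theory.Graph_Theory"
begin

text \<open>
  A finite simple graph is a \<^locale>\<open>pair_graph\<close>: a finite, loop-free, symmetric digraph whose
  arcs are pairs of vertices. The library's \<open>connected\<close> excludes the null graph.
\<close>

text \<open>
  With unit weights the cost of a walk is its length, so the library's shortest-path function is
  the graph distance; it is \<open>\<infinity>\<close> between vertices in different components.
\<close>
definition gdist :: "'a pair_pre_digraph \<Rightarrow> 'a \<Rightarrow> 'a \<Rightarrow> ereal" where
  "gdist G u v = wf_digraph.\<mu> (with_proj G) (\<lambda>_. 1) u v"

definition sphere :: "'a pair_pre_digraph \<Rightarrow> nat \<Rightarrow> 'a \<Rightarrow> 'a set" where
  "sphere G i u = {v \<in> pverts G. gdist G u v = ereal (real i)}"

text \<open>The largest finite distance, also when the graph is disconnected.\<close>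
definition diam :: "'a pair_pre_digraph \<Rightarrow> nat" where
  "diam G = Max {i. \<exists>u\<in>pverts G. \<exists>v\<in>pverts G. gdist G u v = ereal (real i)}"

definition walk_of_length :: "'a pair_pre_digraph \<Rightarrow> nat \<Rightarrow> 'a \<Rightarrow> 'a \<Rightarrow> bool" where
  "walk_of_length G k u v \<longleftrightarrow> (\<exists>p. pre_digraph.awalk (with_proj G) u p v \<and> length p = k)"

definition bipartite :: "'a pair_pre_digraph \<Rightarrow> bool" where
  "bipartite G \<longleftrightarrow>
    (\<exists>X Y. X \<union> Y = pverts G \<and> X \<inter> Y = {} \<and> parcs G \<subseteq> X \<times> Y \<union> Y \<times> X)"

definition direct_product ::
    "'a pair_pre_digraph \<Rightarrow> 'b pair_pre_digraph \<Rightarrow> ('a \<times> 'b) pair_pre_digraph" where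
  "direct_product G H =
    \<lparr> pverts = pverts G \<times> pverts H,
      parcs = {((g1, h1), (g2, h2)) | g1 h1 g2 h2. (g1, g2) \<in> parcs G \<and> (h1, h2) \<in> parcs H} \<rparr>"

definition DDR :: "'a pair_pre_digraph \<Rightarrow> bool" where
  "DDR G \<longleftrightarrow> pair_graph G \<and>
    (\<forall>u\<in>pverts G. \<forall>v\<in>pverts G. \<forall>i. card (sphere G i u) = card (sphere G i v))"

definition CDDR :: "'a pair_pre_digraph \<Rightarrow> bool" where
  "CDDR G \<longleftrightarrow> pair_graph G \<and>
    (\<forall>u\<in>pverts G. \<forall>v\<in>pverts G. \<forall>i\<in>{1..diam G}. \<forall>j\<in>{1..diam G}.
      card (sphere G i u \<inter> sphere G j v) = card (sphere G i v \<inter> sphere G j u))"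

definition mean_intersection ::
    "'a pair_pre_digraph \<Rightarrow> nat \<Rightarrow> nat \<Rightarrow> nat \<Rightarrow> 'a \<Rightarrow> real" where
  "mean_intersection G h i j u =
    (\<Sum>v\<in>sphere G h u. real (card (sphere G i u \<inter> sphere G j v))) / real (card (sphere G h u))"

text \<open>
  The convention \<open>x / 0 = 0\<close> for an empty sphere does not matter here: the case \<open>h = 0\<close>, \<open>i = j\<close>
  says that \<open>card (sphere G i u)\<close> does not depend on \<open>u\<close>, so for \<open>h \<le> diam G\<close> no sphere is empty.
\<close>
definition DMR :: "'a pair_pre_digraph \<Rightarrow> bool" where
  "DMR G \<longleftrightarrow> pair_graph G \<and>
    (\<forall>h\<in>{0..diam G}. \<forall>i\<in>{0..diam G}. \<forall>j\<in>{0..diam G}. \<forall>u\<in>pverts G. \<forall>v\<in>pverts G.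
      mean_intersection G h i j u = mean_intersection G h i j v)"

definition DWR :: "'a pair_pre_digraph \<Rightarrow> bool" where
  "DWR G \<longleftrightarrow> pair_graph G \<and> connected (with_proj G) \<and>
    (\<forall>k. \<forall>u\<in>pverts G. \<forall>v\<in>pverts G. \<forall>u'\<in>pverts G. \<forall>v'\<in>pverts G.
      gdist G u v = gdist G u' v' \<longrightarrow> walk_of_length G k u v = walk_of_length G k u' v')"

end

theory Submission
  imports Defs
begin

text \<open>
  A walk in a direct product is a pair of walks of the same length, one in each factor. Hence the
  distance from \<open>(g, h)\<close> to \<open>(g', h')\<close> is the least \<open>k\<close> for which both factors have a walk of
  length \<open>k\<close> between the respective vertices. In a distance walk regular graph the lengths of the
  walks between two vertices are determined by their distance, so the distance in the product is a
  function of the pair of distances in the factors. A sphere of the product is therefore a disjoint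
  union of rectangles \<open>sphere G a g \<times> sphere H b h\<close>, and the set of radii \<open>(a, b)\<close> that occur does
  not depend on the centre (lemma \<open>sphere_direct_product\<close>). This also covers vertices in different
  components of the product: they are at a pair of distances that occurs for no radius.

  Each of the three regularity conditions concerns a quantity that turns such unions into sums and
  rectangles into products: the size of a sphere (\<open>card_sphere_direct_product\<close>), the size of the
  intersection of two spheres (\<open>card_sphere_Int_direct_product\<close>), and the sum of such sizes over a
  third sphere (\<open>total_intersection_direct_product\<close>). Each term of the resulting sum is a product
  of the corresponding quantities of the factors, which by hypothesis are invariant under a change
  of the centre or, for CDDR, under an exchange of the two centres.
\<close>

section \<open>Walks and distances\<close>

lemma walk_of_length_0:
  assumes "pair_wf_digraph G"
  shows "walk_of_length G 0 u v \<longleftrightarrow> u = v \<and> u \<in> pverts G"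
proof -
  interpret pair_wf_digraph G by fact
  show ?thesis by (auto simp: walk_of_length_def awalk_Nil_iff)
qed

lemma walk_of_length_Suc:
  assumes "pair_wf_digraph G"
  shows "walk_of_length G (Suc k) u v \<longleftrightarrow> (\<exists>w. (u, w) \<in> parcs G \<and> walk_of_length G k w v)"
proof -
  interpret pair_wf_digraph G by fact
  have "walk_of_length G (Suc k) u v \<longleftrightarrow> (\<exists>e p. awalk u (e # p) v \<and> length p = k)"
    unfolding walk_of_length_def by (metis length_Suc_conv)
  also have "\<dots> \<longleftrightarrow> (\<exists>w p. (u, w) \<in> parcs G \<and> awalk w p v \<and> length p = k)"
    by (simp add: awalk_Cons_iff)
  finally show ?thesis by (auto simp: walk_of_length_def)
qed

lemma walk_of_length_in_pverts:
  assumes "pair_wf_digraph G" "walk_of_length G k u v"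
  shows "u \<in> pverts G" "v \<in> pverts G"
proof -
  interpret pair_wf_digraph G by fact
  show "u \<in> pverts G" "v \<in> pverts G"
    using assms(2) awalk_hd_in_verts awalk_last_in_verts by (auto simp: walk_of_length_def)
qed

lemma walk_of_length_sym:
  assumes "pair_graph G" "walk_of_length G k u v"
  shows "walk_of_length G k v u"
proof -
  interpret pair_graph G by fact
  note wf = pair_wf_digraph_axioms
  have snoc: "walk_of_length G (Suc k) u w"
    if "walk_of_length G k u v" "(v, w) \<in> parcs G" for k u v w
    using that
  proof (induction k arbitrary: u)
    case 0
    then have "w \<in> pverts G" using in_arcsD2 by auto
    with 0 show ?case by (auto simp: walk_of_length_0[OF wf] walk_of_length_Suc[OF wf])
  next
    case (Suc k)
    then show ?case by (metis walk_of_length_Suc[OF wf])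
  qed
  show ?thesis
    using assms(2)
  proof (induction k arbitrary: u)
    case 0
    then show ?case by (auto simp: walk_of_length_0[OF wf])
  next
    case (Suc k)
    then obtain w where "(u, w) \<in> parcs G" "walk_of_length G k v w"
      by (auto simp: walk_of_length_Suc[OF wf])
    then show ?case using snoc arcs_symmetric by blast
  qed
qed

text \<open>
  Walk lengths give all later facts about distances, so the infimum in the definition of distance
  is evaluated once and for all: lengths are natural numbers, so it is attained.
\<close>
lemma in_sphere_iff:
  assumes "pair_wf_digraph G"
  shows "v \<in> sphere G i u \<longleftrightarrow> walk_of_length G i u v \<and> (\<forall>k<i. \<not> walk_of_length G k u v)"
proof -
  interpret pair_wf_digraph G by fact
  have cost: "awalk_cost (\<lambda>_. 1) p = real (length p)" for p :: "('a \<times> 'a) list"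
    by (induction p) (auto simp: awalk_cost_def)
  have dist: "gdist G u v = (INF k\<in>{k. walk_of_length G k u v}. ereal (real k))"
    unfolding gdist_def \<mu>_def
    by (rule arg_cong[where f=Inf]) (auto simp: cost walk_of_length_def)
  show ?thesis
  proof (cases "\<exists>k. walk_of_length G k u v")
    case False
    then have "gdist G u v = \<infinity>" unfolding dist by (simp add: top_ereal_def)
    then show ?thesis using False by (auto simp: sphere_def)
  next
    case True
    define m where "m = (LEAST k. walk_of_length G k u v)"
    have m: "walk_of_length G m u v" "\<And>k. walk_of_length G k u v \<Longrightarrow> m \<le> k"
      unfolding m_def using True by (auto intro: LeastI_ex Least_le)
    have "gdist G u v = ereal (real m)"
      unfolding dist by (rule antisym) (auto intro!: INF_lower INF_greatest m)
    moreover have "v \<in> pverts G" using m(1) walk_of_length_in_pverts assms by metis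
    ultimately have "v \<in> sphere G i u \<longleftrightarrow> m = i" by (auto simp: sphere_def)
    also have "\<dots> \<longleftrightarrow> walk_of_length G i u v \<and> (\<forall>k<i. \<not> walk_of_length G k u v)"
      using m by (metis leD le_neq_implies_less)
    finally show ?thesis .
  qed
qed

lemma sphere_0:
  assumes "pair_wf_digraph G" "u \<in> pverts G"
  shows "sphere G 0 u = {u}"
proof (intro set_eqI)
  show "v \<in> sphere G 0 u \<longleftrightarrow> v \<in> {u}" for v
    unfolding in_sphere_iff[OF assms(1)] walk_of_length_0[OF assms(1)] using assms(2) by auto
qed

lemma sphere_sym:
  assumes "pair_graph G"
  shows "v \<in> sphere G i u \<longleftrightarrow> u \<in> sphere G i v"
proof -
  interpret pair_graph G by fact
  show ?thesis
    using walk_of_length_sym[OF assms] in_sphere_iff[OF pair_wf_digraph_axioms] by metis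
qed

lemma finite_sphere:
  assumes "pair_graph G"
  shows "finite (sphere G i u)"
proof -
  interpret pair_graph G by fact
  show ?thesis by (simp add: sphere_def)
qed

text \<open>
  The diameter is a maximum over a set of numbers, so this needs that set to be finite: its members
  are distances of pairs of vertices.
\<close>
lemma sphere_le_diam:
  assumes "pair_graph G" "v \<in> sphere G i u"
  shows "i \<le> diam G"
proof -
  interpret pair_graph G by fact
  let ?D = "{i. \<exists>u\<in>pverts G. \<exists>v\<in>pverts G. gdist G u v = ereal (real i)}"
  have "?D \<subseteq> (\<lambda>(u, v). nat \<lfloor>real_of_ereal (gdist G u v)\<rfloor>) ` (pverts G \<times> pverts G)"
  proof (intro subsetI)
    fix k assume "k \<in> ?D"
    then obtain u v where "u \<in> pverts G" "v \<in> pverts G" "gdist G u v = ereal (real k)"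
      by blast
    then show "k \<in> (\<lambda>(u, v). nat \<lfloor>real_of_ereal (gdist G u v)\<rfloor>) ` (pverts G \<times> pverts G)"
      by (intro image_eqI[of _ _ "(u, v)"]) auto
  qed
  then have "finite ?D" by (rule finite_subset) auto
  moreover have "u \<in> pverts G"
    using assms(2) in_sphere_iff[OF pair_wf_digraph_axioms]
      walk_of_length_in_pverts[OF pair_wf_digraph_axioms] by blast
  then have "i \<in> ?D" using assms(2) by (auto simp: sphere_def)
  ultimately show ?thesis unfolding diam_def by (rule Max_ge)
qed

section \<open>Spheres of a direct product\<close>

lemma pair_graph_direct_product:
  assumes "pair_graph G" "pair_graph H"
  shows "pair_graph (direct_product G H)"
proof -
  interpret G: pair_graph G by fact
  interpret H: pair_graph H by fact
  have sub: "parcs (direct_product G H) \<subseteq> pverts (direct_product G H) \<times> pverts (direct_product G H)"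
    by (auto simp: direct_product_def dest: G.in_arcsD1 G.in_arcsD2 H.in_arcsD1 H.in_arcsD2)
  have fin: "finite (pverts (direct_product G H))"
    by (simp add: direct_product_def)
  have fin_arcs: "finite (parcs (direct_product G H))"
    using finite_subset[OF sub] fin by simp
  show ?thesis
  proof
    show "symmetric (with_proj (direct_product G H))"
      unfolding symmetric_def
      by (auto simp: direct_product_def sym_def intro: G.arcs_symmetric H.arcs_symmetric)
    show "fst e \<noteq> snd e" if "e \<in> parcs (direct_product G H)" for e
      using that by (auto simp: direct_product_def dest: G.pair_no_loops)
    show "fst e \<in> pverts (direct_product G H)" "snd e \<in> pverts (direct_product G H)"
      if "e \<in> parcs (direct_product G H)" for e
      using subsetD[OF sub that] by (simp_all add: mem_Times_iff)
  qed (fact fin fin_arcs)+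
qed

lemma walk_of_length_direct_product:
  assumes "pair_graph G" "pair_graph H"
  shows "walk_of_length (direct_product G H) k (g, h) (g', h') \<longleftrightarrow>
    walk_of_length G k g g' \<and> walk_of_length H k h h'"
proof -
  interpret G: pair_graph G by fact
  interpret H: pair_graph H by fact
  interpret P: pair_graph "direct_product G H" by (rule pair_graph_direct_product) fact+
  note wf = G.pair_wf_digraph_axioms H.pair_wf_digraph_axioms P.pair_wf_digraph_axioms
  show ?thesis
  proof (induction k arbitrary: g h)
    case 0
    show ?case
      unfolding walk_of_length_0[OF wf(1)] walk_of_length_0[OF wf(2)] walk_of_length_0[OF wf(3)]
      by (auto simp: direct_product_def)
  next
    case (Suc k)
    have "walk_of_length (direct_product G H) (Suc k) (g, h) (g', h') \<longleftrightarrow>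
      (\<exists>a b. (g, a) \<in> parcs G \<and> (h, b) \<in> parcs H \<and>
        walk_of_length G k a g' \<and> walk_of_length H k b h')"
      by (auto simp: walk_of_length_Suc[OF wf(3)] Suc.IH[symmetric]) (auto simp: direct_product_def)
    then show ?case by (auto simp: walk_of_length_Suc[OF wf(1)] walk_of_length_Suc[OF wf(2)])
  qed
qed

text \<open>
  In a distance walk regular graph, the walks of length \<open>k\<close> between two vertices at distance \<open>a\<close>
  exist for all such pairs as soon as they exist for one.
\<close>
definition length_realised :: "'a pair_pre_digraph \<Rightarrow> nat \<Rightarrow> nat \<Rightarrow> bool" where
  "length_realised G k a \<longleftrightarrow> (\<exists>u. \<exists>v\<in>sphere G a u. walk_of_length G k u v)"

lemma DWR_imp_pair_graph: "DWR G \<Longrightarrow> pair_graph G"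
  unfolding DWR_def by (rule conjunct1)

lemma DWR_walk_iff_length_realised:
  assumes "DWR G" "v \<in> sphere G a u"
  shows "walk_of_length G k u v \<longleftrightarrow> length_realised G k a"
proof -
  interpret pair_graph G using assms(1) by (rule DWR_imp_pair_graph)
  have V: "u \<in> pverts G \<and> v \<in> pverts G" if "v \<in> sphere G a u" for u v
    using that walk_of_length_in_pverts[OF pair_wf_digraph_axioms, of a u v]
    by (simp add: in_sphere_iff[OF pair_wf_digraph_axioms])
  have "walk_of_length G k u v \<longleftrightarrow> walk_of_length G k u' v'" if "v' \<in> sphere G a u'" for u' v'
  proof -
    have "gdist G u v = gdist G u' v'" using that assms(2) by (simp add: sphere_def)
    moreover have "u \<in> pverts G" "v \<in> pverts G" "u' \<in> pverts G" "v' \<in> pverts G"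
      using V that assms(2) by blast+
    ultimately show ?thesis using assms(1) unfolding DWR_def by blast
  qed
  then show ?thesis using assms(2) unfolding length_realised_def by blast
qed

text \<open>
  The pairs of distances in the factors that give distance \<open>i\<close> in the product. A set for each \<open>i\<close>
  takes the place of a function of the pair, whose value would be infinite when no walk length is
  common to both distances. The bounds by the diameters make the set finite and keep all radii in
  the range of the CDDR and DMR conditions.
\<close>
definition dist_pairs ::
    "'a pair_pre_digraph \<Rightarrow> 'b pair_pre_digraph \<Rightarrow> nat \<Rightarrow> (nat \<times> nat) set" where
  "dist_pairs G H i = {(a, b). a \<le> diam G \<and> b \<le> diam H \<and>
    length_realised G i a \<and> length_realised H i b \<and>
    (\<forall>k<i. \<not> (length_realised G k a \<and> length_realised H k b))}"

lemma finite_dist_pairs: "finite (dist_pairs G H i)"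
proof (rule finite_subset)
  show "dist_pairs G H i \<subseteq> {..diam G} \<times> {..diam H}"
    unfolding dist_pairs_def by auto
qed simp

text \<open>
  Membership on either side is about the least walk length common to both factors; replacing each
  walk condition by the one for the distance removes the vertices from it. A vertex reached by a
  walk has a finite distance, which supplies the radii.
\<close>
lemma sphere_direct_product:
  assumes "DWR G" "DWR H"
  shows "sphere (direct_product G H) i (g, h) =
    (\<Union>(a, b)\<in>dist_pairs G H i. sphere G a g \<times> sphere H b h)"
proof -
  note pg = DWR_imp_pair_graph[OF assms(1)] DWR_imp_pair_graph[OF assms(2)]
  interpret G: pair_graph G by (fact pg)
  interpret H: pair_graph H by (fact pg)
  interpret P: pair_graph "direct_product G H" by (rule pair_graph_direct_product) fact+
  note wf = G.pair_wf_digraph_axioms H.pair_wf_digraph_axioms P.pair_wf_digraph_axioms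
  have in_sphere: "(g', h') \<in> sphere (direct_product G H) i (g, h) \<longleftrightarrow>
      (walk_of_length G i g g' \<and> walk_of_length H i h h') \<and>
      (\<forall>k<i. \<not> (walk_of_length G k g g' \<and> walk_of_length H k h h'))" for g' h'
    unfolding in_sphere_iff[OF wf(3)] walk_of_length_direct_product[OF pg] ..
  have ex_sphere: "\<exists>a. v \<in> sphere K a u" if "pair_wf_digraph K" "walk_of_length K k u v"
    for k u v and K :: "'c pair_pre_digraph"
    unfolding in_sphere_iff[OF that(1)] using that(2) exists_least_iff[of "\<lambda>k. walk_of_length K k u v"]
    by blast
  have "(g', h') \<in> sphere (direct_product G H) i (g, h) \<longleftrightarrow>
      (\<exists>(a, b)\<in>dist_pairs G H i. g' \<in> sphere G a g \<and> h' \<in> sphere H b h)" for g' h'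
  proof
    assume L: "(g', h') \<in> sphere (direct_product G H) i (g, h)"
    then obtain a b where ab: "g' \<in> sphere G a g" "h' \<in> sphere H b h"
      using in_sphere ex_sphere wf(1,2) by meson
    then have "(a, b) \<in> dist_pairs G H i"
      using L sphere_le_diam[OF pg(1) ab(1)] sphere_le_diam[OF pg(2) ab(2)]
      by (simp add: in_sphere dist_pairs_def DWR_walk_iff_length_realised[OF assms(1) ab(1)]
          DWR_walk_iff_length_realised[OF assms(2) ab(2)])
    with ab show "\<exists>(a, b)\<in>dist_pairs G H i. g' \<in> sphere G a g \<and> h' \<in> sphere H b h" by auto
  next
    assume "\<exists>(a, b)\<in>dist_pairs G H i. g' \<in> sphere G a g \<and> h' \<in> sphere H b h"
    then obtain a b where ab: "g' \<in> sphere G a g" "h' \<in> sphere H b h" "(a, b) \<in> dist_pairs G H i"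
      by auto
    then show "(g', h') \<in> sphere (direct_product G H) i (g, h)"
      by (simp add: in_sphere dist_pairs_def DWR_walk_iff_length_realised[OF assms(1) ab(1)]
          DWR_walk_iff_length_realised[OF assms(2) ab(2)])
  qed
  then show ?thesis by auto
qed

text \<open>
  The rectangles are disjoint because the radii of a rectangle can be read off from each of its
  points. All counting in the product is a special case of this summation.
\<close>
lemma sum_sphere_direct_product:
  fixes f :: "'a \<times> 'b \<Rightarrow> 'c::comm_monoid_add"
  assumes "DWR G" "DWR H"
  shows "(\<Sum>x\<in>sphere (direct_product G H) i (g, h). f x) =
    (\<Sum>(a, b)\<in>dist_pairs G H i. \<Sum>g'\<in>sphere G a g. \<Sum>h'\<in>sphere H b h. f (g', h'))"
proof -
  have fin: "finite (sphere G a u)" "finite (sphere H b v)" for a b u v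
    by (intro finite_sphere DWR_imp_pair_graph assms)+
  have "(\<Sum>x\<in>sphere (direct_product G H) i (g, h). f x) =
    (\<Sum>p\<in>dist_pairs G H i. \<Sum>x\<in>(case p of (a, b) \<Rightarrow> sphere G a g \<times> sphere H b h). f x)"
    unfolding sphere_direct_product[OF assms]
  proof (rule sum.UNION_disjoint)
    show "\<forall>p\<in>dist_pairs G H i. \<forall>q\<in>dist_pairs G H i. p \<noteq> q \<longrightarrow>
        (case p of (a, b) \<Rightarrow> sphere G a g \<times> sphere H b h) \<inter>
        (case q of (a, b) \<Rightarrow> sphere G a g \<times> sphere H b h) = {}"
      by (auto simp: sphere_def)
  qed (auto simp: finite_dist_pairs fin)
  also have "\<dots> = (\<Sum>(a, b)\<in>dist_pairs G H i. \<Sum>g'\<in>sphere G a g. \<Sum>h'\<in>sphere H b h. f (g', h'))"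
    by (intro sum.cong refl) (auto simp: sum.cartesian_product)
  finally show ?thesis .
qed

lemma sum_swap_spheres_dist_pairs:
  "(\<Sum>x\<in>sphere G a g. \<Sum>y\<in>sphere H b h. \<Sum>p\<in>dist_pairs G H k. f x y p) =
    (\<Sum>p\<in>dist_pairs G H k. \<Sum>x\<in>sphere G a g. \<Sum>y\<in>sphere H b h. f x y p)"
proof -
  have "(\<Sum>x\<in>sphere G a g. \<Sum>y\<in>sphere H b h. \<Sum>p\<in>dist_pairs G H k. f x y p) =
      (\<Sum>x\<in>sphere G a g. \<Sum>p\<in>dist_pairs G H k. \<Sum>y\<in>sphere H b h. f x y p)"
    by (rule sum.cong[OF refl sum.swap])
  also have "\<dots> = (\<Sum>p\<in>dist_pairs G H k. \<Sum>x\<in>sphere G a g. \<Sum>y\<in>sphere H b h. f x y p)"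
    by (rule sum.swap)
  finally show ?thesis .
qed

lemma card_sphere_direct_product:
  assumes "DWR G" "DWR H"
  shows "card (sphere (direct_product G H) i (g, h)) =
    (\<Sum>(a, b)\<in>dist_pairs G H i. card (sphere G a g) * card (sphere H b h))"
proof -
  have "card (sphere (direct_product G H) i (g, h)) =
      (\<Sum>x\<in>sphere (direct_product G H) i (g, h). 1)"
    by (rule card_eq_sum)
  also have "\<dots> = (\<Sum>(a, b)\<in>dist_pairs G H i. \<Sum>g'\<in>sphere G a g. \<Sum>h'\<in>sphere H b h. 1)"
    by (rule sum_sphere_direct_product[OF assms])
  also have "\<dots> = (\<Sum>(a, b)\<in>dist_pairs G H i. card (sphere G a g) * card (sphere H b h))"
    by simp
  finally show ?thesis .
qed

text \<open>
  Rectangles intersect in rectangles. In terms of sums: the size of the intersection is the sum,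
  over the first sphere, of the indicator of the second one, and that indicator is itself a sum of
  products of indicators.
\<close>
lemma card_sphere_Int_direct_product:
  assumes "DWR G" "DWR H"
  shows "card (sphere (direct_product G H) i (g, h) \<inter> sphere (direct_product G H) j (g', h')) =
    (\<Sum>(a, b)\<in>dist_pairs G H i. \<Sum>(c, d)\<in>dist_pairs G H j.
      card (sphere G a g \<inter> sphere G c g') * card (sphere H b h \<inter> sphere H d h'))"
proof -
  note pg = DWR_imp_pair_graph[OF assms(1)] DWR_imp_pair_graph[OF assms(2)]
  have fin: "finite (sphere G a u)" "finite (sphere H b v)"
    "finite (sphere (direct_product G H) c x)" for a b c u v x
    by (intro finite_sphere pair_graph_direct_product pg)+
  have card_Int: "card (A \<inter> B) = (\<Sum>x\<in>A. of_bool (x \<in> B))" if "finite A" for A B :: "'c set"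
    unfolding of_bool_def card_eq_sum by (rule sum.inter_restrict[OF that])
  \<comment> \<open>The indicator of the second sphere is obtained by summing the indicator of the point over it.\<close>
  have pick: "of_bool ((x, y) \<in> sphere (direct_product G H) j (g', h')) =
      (\<Sum>(c, d)\<in>dist_pairs G H j.
        of_bool (x \<in> sphere G c g') * of_bool (y \<in> sphere H d h') :: nat)" for x y
  proof -
    have "of_bool ((x, y) \<in> sphere (direct_product G H) j (g', h')) =
        (\<Sum>z\<in>sphere (direct_product G H) j (g', h'). of_bool (z = (x, y)) :: nat)"
      by (simp add: fin of_bool_def)
    also have "\<dots> = (\<Sum>(c, d)\<in>dist_pairs G H j.
        \<Sum>u\<in>sphere G c g'. \<Sum>v\<in>sphere H d h'. of_bool (u = x) * of_bool (v = y))"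
      unfolding sum_sphere_direct_product[OF assms]
      by (simp only: prod.inject of_bool_conj)
    also have "\<dots> = (\<Sum>(c, d)\<in>dist_pairs G H j.
        (\<Sum>u\<in>sphere G c g'. of_bool (u = x)) * (\<Sum>v\<in>sphere H d h'. of_bool (v = y)))"
      by (simp only: sum_product)
    also have "\<dots> = (\<Sum>(c, d)\<in>dist_pairs G H j.
        of_bool (x \<in> sphere G c g') * of_bool (y \<in> sphere H d h'))"
      by (intro sum.cong refl) (auto simp: fin of_bool_def)
    finally show ?thesis .
  qed
  have "card (sphere (direct_product G H) i (g, h) \<inter> sphere (direct_product G H) j (g', h')) =
    (\<Sum>(a, b)\<in>dist_pairs G H i. \<Sum>x\<in>sphere G a g. \<Sum>y\<in>sphere H b h.
      \<Sum>(c, d)\<in>dist_pairs G H j. of_bool (x \<in> sphere G c g') * of_bool (y \<in> sphere H d h'))"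
    by (simp only: card_Int[OF fin(3)] sum_sphere_direct_product[OF assms] pick)
  also have "\<dots> = (\<Sum>(a, b)\<in>dist_pairs G H i. \<Sum>(c, d)\<in>dist_pairs G H j.
      (\<Sum>x\<in>sphere G a g. \<Sum>y\<in>sphere H b h.
        of_bool (x \<in> sphere G c g') * of_bool (y \<in> sphere H d h')))"
    by (simp only: sum_swap_spheres_dist_pairs case_prod_unfold)
  also have "\<dots> = (\<Sum>(a, b)\<in>dist_pairs G H i. \<Sum>(c, d)\<in>dist_pairs G H j.
      card (sphere G a g \<inter> sphere G c g') * card (sphere H b h \<inter> sphere H d h'))"
    by (simp only: card_Int[OF fin(1)] card_Int[OF fin(2)] sum_product)
  finally show ?thesis .
qed

section \<open>Regularity of the product\<close>

lemma DDR_direct_product: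
  assumes "DWR G" "DWR H" "DDR G" "DDR H"
  shows "DDR (direct_product G H)"
  unfolding DDR_def
proof (intro conjI ballI allI)
  show "pair_graph (direct_product G H)"
    by (intro pair_graph_direct_product DWR_imp_pair_graph assms(1,2))
next
  fix x y i
  assume "x \<in> pverts (direct_product G H)" "y \<in> pverts (direct_product G H)"
  then obtain g h g' h' where xy: "x = (g, h)" "y = (g', h')"
    and V: "g \<in> pverts G" "h \<in> pverts H" "g' \<in> pverts G" "h' \<in> pverts H"
    by (auto simp: direct_product_def)
  have "card (sphere G a g) = card (sphere G a g')" "card (sphere H a h) = card (sphere H a h')" for a
    using assms(3,4) V unfolding DDR_def by blast+
  then show "card (sphere (direct_product G H) i x) = card (sphere (direct_product G H) i y)"
    by (simp add: xy card_sphere_direct_product[OF assms(1,2)])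
qed

text \<open>
  A pair of distances with positive distance in the product may still contain a zero, and radius
  \<open>0\<close> is outside the CDDR condition. There the symmetry of the distance suffices: intersecting
  with \<open>{u}\<close> only tests a distance between \<open>u\<close> and \<open>v\<close>.
\<close>
lemma CDDR_all_radii:
  assumes "CDDR G" "u \<in> pverts G" "v \<in> pverts G"
  shows "card (sphere G i u \<inter> sphere G j v) = card (sphere G i v \<inter> sphere G j u)"
proof -
  have pg: "pair_graph G" using assms(1) unfolding CDDR_def by (rule conjunct1)
  interpret pair_graph G by (fact pg)
  note s0 = sphere_0[OF pair_wf_digraph_axioms]
  consider "i = 0" | "j = 0" | "i > diam G" | "j > diam G"
    | "i \<in> {1..diam G}" "j \<in> {1..diam G}" by force
  then show ?thesis
  proof cases
    case 1
    then show ?thesis using sphere_sym[OF pg, of v j u] by (simp add: s0 assms Int_insert_left)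
  next
    case 2
    then show ?thesis using sphere_sym[OF pg, of v i u] by (simp add: s0 assms Int_insert_right)
  next
    case 3
    then have "sphere G i w = {}" for w using sphere_le_diam[OF pg] by fastforce
    then show ?thesis by simp
  next
    case 4
    then have "sphere G j w = {}" for w using sphere_le_diam[OF pg] by fastforce
    then show ?thesis by simp
  next
    case 5
    then show ?thesis using assms unfolding CDDR_def by blast
  qed
qed

lemma CDDR_direct_product:
  assumes "DWR G" "DWR H" "CDDR G" "CDDR H"
  shows "CDDR (direct_product G H)"
  unfolding CDDR_def
proof (intro conjI ballI)
  show "pair_graph (direct_product G H)"
    by (intro pair_graph_direct_product DWR_imp_pair_graph assms(1,2))
next
  fix x y i j
  assume "x \<in> pverts (direct_product G H)" "y \<in> pverts (direct_product G H)"
  then obtain g h g' h' where xy: "x = (g, h)" "y = (g', h')"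
    and V: "g \<in> pverts G" "h \<in> pverts H" "g' \<in> pverts G" "h' \<in> pverts H"
    by (auto simp: direct_product_def)
  show "card (sphere (direct_product G H) i x \<inter> sphere (direct_product G H) j y) =
      card (sphere (direct_product G H) i y \<inter> sphere (direct_product G H) j x)"
    unfolding xy card_sphere_Int_direct_product[OF assms(1,2)]
      CDDR_all_radii[OF assms(3) V(1,3)] CDDR_all_radii[OF assms(4) V(2,4)] ..
qed

text \<open>
  The numerator of the mean. Unlike the mean itself, it is compatible with disjoint unions of
  rectangles, since the divisor of the mean in the product is a sum.
\<close>
definition total_intersection ::
    "'a pair_pre_digraph \<Rightarrow> nat \<Rightarrow> nat \<Rightarrow> nat \<Rightarrow> 'a \<Rightarrow> nat" where
  "total_intersection G h i j u = (\<Sum>v\<in>sphere G h u. card (sphere G i u \<inter> sphere G j v))"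

lemma mean_intersection_eq:
  "mean_intersection G h i j u = real (total_intersection G h i j u) / real (card (sphere G h u))"
  by (simp add: mean_intersection_def total_intersection_def)

lemma DMR_mean_intersection:
  assumes "DMR G" "u \<in> pverts G" "v \<in> pverts G" "h \<le> diam G" "i \<le> diam G" "j \<le> diam G"
  shows "mean_intersection G h i j u = mean_intersection G h i j v"
proof -
  have "h \<in> {0..diam G}" "i \<in> {0..diam G}" "j \<in> {0..diam G}"
    using assms by simp_all
  then show ?thesis using assms(1-3) unfolding DMR_def by blast
qed

text \<open>
  The sphere of radius \<open>0\<close> consists of its centre, so the mean for \<open>h = 0\<close> and \<open>i = j\<close> is the
  size of the sphere of radius \<open>i\<close>. Radii above the diameter give empty spheres.
\<close>
lemma DMR_imp_DDR:
  assumes "DMR G"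
  shows "DDR G"
  unfolding DDR_def
proof (intro conjI ballI allI)
  show pg: "pair_graph G" using assms(1) unfolding DMR_def by (rule conjunct1)
  interpret pair_graph G by (fact pg)
  fix u v i
  assume V: "u \<in> pverts G" "v \<in> pverts G"
  have mean: "mean_intersection G 0 i i w = card (sphere G i w)" if "w \<in> pverts G" for w
    by (simp add: mean_intersection_def sphere_0[OF pair_wf_digraph_axioms that])
  show "card (sphere G i u) = card (sphere G i v)"
  proof (cases "i \<le> diam G")
    case True
    then have "mean_intersection G 0 i i u = mean_intersection G 0 i i v"
      by (intro DMR_mean_intersection assms V) simp_all
    then show ?thesis by (simp add: mean V)
  next
    case False
    then have "sphere G i w = {}" for w using sphere_le_diam[OF pg] by fastforce
    then show ?thesis by simp
  qed
qed

text \<open>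
  By the previous lemma, the means for two centres have the same divisor, so their numerators agree
  too.
\<close>
lemma DMR_total_intersection:
  assumes "DMR G" "u \<in> pverts G" "v \<in> pverts G" "h \<le> diam G" "i \<le> diam G" "j \<le> diam G"
  shows "total_intersection G h i j u = total_intersection G h i j v"
proof -
  have pg: "pair_graph G" using assms(1) unfolding DMR_def by (rule conjunct1)
  have card_eq: "card (sphere G h u) = card (sphere G h v)"
    using DMR_imp_DDR[OF assms(1)] assms(2,3) unfolding DDR_def by blast
  show ?thesis
  proof (cases "card (sphere G h u) = 0")
    case True
    then have "sphere G h u = {}" "sphere G h v = {}"
      using card_eq finite_sphere[OF pg] by auto
    then show ?thesis by (simp add: total_intersection_def)
  next
    case False
    have "mean_intersection G h i j u = mean_intersection G h i j v"
      using assms by (rule DMR_mean_intersection)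
    then show ?thesis using False card_eq by (simp add: mean_intersection_eq)
  qed
qed

lemma total_intersection_direct_product:
  assumes "DWR G" "DWR H"
  shows "total_intersection (direct_product G H) l i j (g, h) =
    (\<Sum>(p, q)\<in>dist_pairs G H l. \<Sum>(a, b)\<in>dist_pairs G H i. \<Sum>(c, d)\<in>dist_pairs G H j.
      total_intersection G p a c g * total_intersection H q b d h)"
  unfolding total_intersection_def sum_sphere_direct_product[OF assms]
    card_sphere_Int_direct_product[OF assms] sum_product
  by (simp only: sum_swap_spheres_dist_pairs case_prod_unfold)

lemma DMR_direct_product:
  assumes "DWR G" "DWR H" "DMR G" "DMR H"
  shows "DMR (direct_product G H)"
  unfolding DMR_def
proof (intro conjI ballI)
  show "pair_graph (direct_product G H)"
    by (intro pair_graph_direct_product DWR_imp_pair_graph assms(1,2))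
next
  fix l i j x y
  assume xy_in: "x \<in> pverts (direct_product G H)" "y \<in> pverts (direct_product G H)"
  then obtain g h g' h' where xy: "x = (g, h)" "y = (g', h')"
    and V: "g \<in> pverts G" "h \<in> pverts H" "g' \<in> pverts G" "h' \<in> pverts H"
    by (auto simp: direct_product_def)
  have "card (sphere (direct_product G H) l x) = card (sphere (direct_product G H) l y)"
    using DDR_direct_product[OF assms(1,2) assms(3,4)[THEN DMR_imp_DDR]] xy_in
    unfolding DDR_def by blast
  moreover have "total_intersection (direct_product G H) l i j x =
      total_intersection (direct_product G H) l i j y"
    unfolding xy total_intersection_direct_product[OF assms(1,2)]
  proof (intro sum.cong refl, clarify, intro sum.cong refl, clarify, intro sum.cong refl, clarify)
    fix p q a b c d
    assume "(p, q) \<in> dist_pairs G H l" "(a, b) \<in> dist_pairs G H i" "(c, d) \<in> dist_pairs G H j"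
    then have "p \<le> diam G" "q \<le> diam H" "a \<le> diam G" "b \<le> diam H" "c \<le> diam G" "d \<le> diam H"
      by (auto simp: dist_pairs_def)
    then show "total_intersection G p a c g * total_intersection H q b d h =
        total_intersection G p a c g' * total_intersection H q b d h'"
      using DMR_total_intersection[OF assms(3) V(1,3), of p a c]
        DMR_total_intersection[OF assms(4) V(2,4), of q b d] by simp
  qed
  ultimately show "mean_intersection (direct_product G H) l i j x =
      mean_intersection (direct_product G H) l i j y"
    by (simp add: mean_intersection_eq)
qed

theorem theorem5p12:
  fixes G :: "'a pair_pre_digraph" and H :: "'b pair_pre_digraph"
  assumes "pair_graph G" and "pair_graph H"
    and "connected (with_proj G)" and "connected (with_proj H)"
    and "DWR G" and "DWR H"
    and "\<not> bipartite G \<or> \<not> bipartite H"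
  shows "(DDR G \<and> DDR H \<longrightarrow> DDR (direct_product G H)) \<and>
    (CDDR G \<and> CDDR H \<longrightarrow> CDDR (direct_product G H)) \<and>
    (DMR G \<and> DMR H \<longrightarrow> DMR (direct_product G H))"
  using DDR_direct_product[OF assms(5,6)] CDDR_direct_product[OF assms(5,6)]
    DMR_direct_product[OF assms(5,6)]
  by blast

end
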